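(* Let $0<p<1$. Consider a row of $n$ seats with a single entrance, filled by $p$-courteous theatregoers choosing seats according to the left-biased Zipf distribution (model described in the context), and let $L_n$ be the expected number of occupied seats when the process ends. Let $h_0:=0$ and $h_k:=\frac{1}{kH_k}$ for $k\ge1$. Then, asymptotically in $n$ (i.e. the ratio of the two sides tends to $1$ as $n\to\infty$), $$L_n\sim\ln\ln n+\sum_{l=1}^n\sum_{k=1}^l p^k(1-h_l)(1-h_{l-1})\cdots(1-h_{l-k+1})\,h_{l-k}.$$ In particular, for constant $0<p<1$, $L_n=\Theta\!\left(\frac{\ln\ln n}{1-p}\right)$ as $n\to\infty$.
   Context: Row model: a row of $n$ seats with a single entrance at one end. Theatregoers arrive one at a time; each is, independently, courteous with probability $p$ and selfish with probability $1-p$, and this status never changes. A seated selfish theatregoer never gets up, so no later theatregoer can walk past her seat; a seated courteous theatregoer never blocks. An empty seat is accessible if it can be reached from the entrance without passing a seat occupied by a selfish theatregoer. When there are $m\ge1$ accessible empty seats, labelled $1,\dots,m$ in increasing order of distance from the entrance, the arriving theatregoer sits in the $k$-th one with probability $\frac{1}{kH_m}$, where $H_m=\sum_{i=1}^m\frac1i$ (left-biased Zipf distribution). The process ends when no accessible empty seat remains. *)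

theory Defs
  imports "HOL-Probability.Probability" "HOL-Library.Landau_Symbols"
begin

datatype theatregoer = Courteous | Selfish

text \<open>Seats are \<open>1, \<dots>, n\<close> in increasing order of distance from the entrance; a configuration
  maps a seat to its occupant, if any.\<close>

type_synonym config = "nat \<Rightarrow> theatregoer option"

definition accessible :: "nat \<Rightarrow> config \<Rightarrow> nat set" where
  "accessible n \<sigma> = {s \<in> {1..n}. \<sigma> s = None \<and> (\<forall>t \<in> {1..<s}. \<sigma> t \<noteq> Some Selfish)}"

definition occupied :: "nat \<Rightarrow> config \<Rightarrow> nat set" where
  "occupied n \<sigma> = {s \<in> {1..n}. \<sigma> s \<noteq> None}"

definition zipf_h :: "nat \<Rightarrow> real" where
  "zipf_h k = (if k = 0 then 0 else 1 / (real k * harm k))"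

text \<open>The left-biased Zipf distribution; only meaningful for \<open>m \<ge> 1\<close>.\<close>

definition zipf_pmf :: "nat \<Rightarrow> nat pmf" where
  "zipf_pmf m = embed_pmf (\<lambda>k. if k \<in> {1..m} then 1 / (real k * harm m) else 0)"

lemma pmf_zipf_pmf:
  assumes "m \<ge> 1"
  shows "pmf (zipf_pmf m) k = (if k \<in> {1..m} then 1 / (real k * harm m) else 0)"
  unfolding zipf_pmf_def
proof (rule pmf_embed_pmf)
  let ?f = "\<lambda>k. if k \<in> {1..m} then 1 / (real k * harm m) else (0::real)"
  have pos: "harm m > (0::real)" using assms by (simp add: harm_pos)
  show nonneg: "0 \<le> ?f x" for x by (simp add: harm_nonneg)
  have "(\<integral>\<^sup>+ x. ennreal (?f x) \<partial>count_space UNIV) = (\<Sum>x\<in>{1..m}. ennreal (?f x))"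
    by (rule nn_integral_count_space') auto
  also have "\<dots> = ennreal (\<Sum>x\<in>{1..m}. ?f x)" by (rule sum_ennreal) (rule nonneg)
  also have "(\<Sum>x\<in>{1..m}. ?f x) = (\<Sum>x\<in>{1..m}. inverse (real x)) / harm m"
    by (simp add: sum_divide_distrib field_simps)
  also have "(\<Sum>x\<in>{1..m}. inverse (real x)) = harm m" by (simp add: harm_def)
  also have "harm m / harm m = (1::real)" using pos by (metis divide_self less_irrefl)
  finally show "(\<integral>\<^sup>+ x. ennreal (?f x) \<partial>count_space UNIV) = 1" by simp
qed

lemma set_zipf_pmf:
  assumes "m \<ge> 1"
  shows "set_pmf (zipf_pmf m) = {1..m}"
proof -
  have "harm m \<noteq> (0::real)" using harm_pos[of m, where ?'a = real] assms by linarith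
  then show ?thesis by (auto simp: set_pmf_eq pmf_zipf_pmf[OF assms] split: if_splits)
qed

text \<open>One arrival. A configuration without accessible empty seats is left unchanged.\<close>

definition arrival :: "nat \<Rightarrow> real \<Rightarrow> config \<Rightarrow> config pmf" where
  "arrival n p \<sigma> =
     (let A = accessible n \<sigma> in
      if A = {} then return_pmf \<sigma>
      else do {
        courteous \<leftarrow> bernoulli_pmf p;
        k \<leftarrow> zipf_pmf (card A);
        return_pmf (\<sigma>(sorted_list_of_set A ! (k - 1) \<mapsto> (if courteous then Courteous else Selfish)))
      })"

fun row_process :: "nat \<Rightarrow> real \<Rightarrow> nat \<Rightarrow> config pmf" where
  "row_process n p 0 = return_pmf Map.empty"
| "row_process n p (Suc t) = bind_pmf (row_process n p t) (arrival n p)"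

text \<open>Every arrival fills a seat, so the process has ended after at most \<open>n\<close> arrivals
  (lemma \<open>row_process_ended\<close> below), and its configuration is then final.\<close>

definition final_config :: "nat \<Rightarrow> real \<Rightarrow> config pmf" where
  "final_config n p = row_process n p n"

definition expected_occupied :: "real \<Rightarrow> nat \<Rightarrow> real" where
  "expected_occupied p n =
     measure_pmf.expectation (final_config n p) (\<lambda>\<sigma>. real (card (occupied n \<sigma>)))"

lemma finite_accessible [simp]: "finite (accessible n \<sigma>)"
  by (simp add: accessible_def)

lemma card_accessible_arrival:
  assumes "\<tau> \<in> set_pmf (arrival n p \<sigma>)"
  shows "card (accessible n \<tau>) \<le> card (accessible n \<sigma>) - 1"
proof (cases "accessible n \<sigma> = {}")
  case True
  then show ?thesis using assms by (simp add: arrival_def)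
next
  case False
  let ?A = "accessible n \<sigma>"
  have card: "card ?A \<ge> 1" using False by (simp add: Suc_le_eq card_gt_0_iff)
  obtain k x where k: "k \<in> {1..card ?A}"
    and \<tau>: "\<tau> = \<sigma>(sorted_list_of_set ?A ! (k - 1) \<mapsto> x)"
  proof -
    obtain b k where "k \<in> set_pmf (zipf_pmf (card ?A))"
      and "\<tau> = \<sigma>(sorted_list_of_set ?A ! (k - 1) \<mapsto> (if b then Courteous else Selfish))"
      using assms False unfolding arrival_def Let_def by (auto simp del: fun_upd_apply)
    then show ?thesis using that set_zipf_pmf[OF card] by metis
  qed
  define s where "s = sorted_list_of_set ?A ! (k - 1)"
  have \<tau>s: "\<tau> = \<sigma>(s \<mapsto> x)" by (simp add: \<tau> s_def)
  have "k - 1 < length (sorted_list_of_set ?A)" using k by auto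
  then have s: "s \<in> ?A"
    unfolding s_def by (metis finite_accessible nth_mem set_sorted_list_of_set)
  have "accessible n \<tau> \<subseteq> ?A - {s}"
  proof
    fix u assume u: "u \<in> accessible n \<tau>"
    have "u \<noteq> s" using u by (auto simp: accessible_def \<tau>s split: if_splits)
    moreover have "\<sigma> t \<noteq> Some Selfish" if "t \<in> {1..<u}" for t
    proof (cases "t = s")
      case True
      then show ?thesis using s by (simp add: accessible_def)
    next
      case False
      have "\<tau> t \<noteq> Some Selfish" using u that by (auto simp: accessible_def)
      then show ?thesis using False by (simp add: \<tau>s)
    qed
    ultimately show "u \<in> ?A - {s}" using u by (auto simp: accessible_def \<tau>s split: if_splits)
  qed
  then have "card (accessible n \<tau>) \<le> card (?A - {s})" by (intro card_mono) auto
  then show ?thesis using s by simp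
qed

lemma card_accessible_row_process:
  "\<sigma> \<in> set_pmf (row_process n p t) \<Longrightarrow> card (accessible n \<sigma>) \<le> n - t"
proof (induction t arbitrary: \<sigma>)
  case 0
  have "card (accessible n \<sigma>) \<le> card {1..n}" by (intro card_mono) (auto simp: accessible_def)
  then show ?case by simp
next
  case (Suc t)
  then obtain \<rho> where \<rho>: "\<rho> \<in> set_pmf (row_process n p t)" "\<sigma> \<in> set_pmf (arrival n p \<rho>)"
    by auto
  show ?case using Suc.IH[OF \<rho>(1)] card_accessible_arrival[OF \<rho>(2)] by linarith
qed

lemma row_process_ended:
  "\<sigma> \<in> set_pmf (final_config n p) \<Longrightarrow> accessible n \<sigma> = {}"
  using card_accessible_row_process[of \<sigma> n p n] by (simp add: final_config_def)

end

theory Submission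
  imports Defs
begin

text \<open>Let \<open>L m\<close> be the expected number of seats still to be filled when \<open>m\<close> empty seats are
  accessible. A courteous arrival leads from \<open>m\<close> to \<open>m - 1\<close>, a selfish one in the \<open>k\<close>-th
  accessible seat to \<open>k - 1\<close>, so
  \<open>H\<^sub>m L m = H\<^sub>m + p H\<^sub>m L (m - 1) + (1 - p) (\<Sum>k=1..m. L (k - 1) / k)\<close>. Subtracting consecutive
  instances, the increments \<open>d m = L m - L (m - 1)\<close> satisfy \<open>d m = h\<^sub>m + p (1 - h\<^sub>m) d (m - 1)\<close>;
  unfolding this gives \<open>L n = (\<Sum>l=1..n. h\<^sub>l)\<close> plus exactly the double sum of the theorem.
  As \<open>H\<^sub>l\<^sub>-\<^sub>1 / H\<^sub>l = 1 - h\<^sub>l\<close>, the sum of the \<open>h\<^sub>l\<close> is within a constant of \<open>ln H\<^sub>n\<close>, hence of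
  \<open>ln (ln n)\<close>. Finally \<open>d m \<le> h\<^sub>m + p d (m - 1)\<close> sums up to \<open>(1 - p) L n \<le> (\<Sum>l=1..n. h\<^sub>l)\<close>.\<close>

subsection \<open>The recursion for the expected number of further arrivals\<close>

text \<open>These are the increments \<open>d m\<close>. Their recurrence serves as the definition,
  so the equation for \<open>L\<close> from which it was derived becomes the lemma
  \<open>harm_times_occ_mean\<close>.\<close>

primrec occ_incr :: "real \<Rightarrow> nat \<Rightarrow> real" where
  "occ_incr p 0 = 0"
| "occ_incr p (Suc m) = zipf_h (Suc m) + p * (1 - zipf_h (Suc m)) * occ_incr p m"

definition occ_mean :: "real \<Rightarrow> nat \<Rightarrow> real" where
  "occ_mean p n = (\<Sum>l=1..n. occ_incr p l)"

lemma occ_mean_0 [simp]: "occ_mean p 0 = 0"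
  by (simp add: occ_mean_def)

lemma occ_mean_Suc: "occ_mean p (Suc n) = occ_mean p n + occ_incr p (Suc n)"
  by (simp add: occ_mean_def)

lemma occ_mean_eq_pred: "occ_mean p n = occ_mean p (n - 1) + occ_incr p n"
  by (cases n) (simp_all add: occ_mean_Suc del: occ_incr.simps(2))

lemma harm_times_zipf_h: "harm (Suc m) * zipf_h (Suc m) = 1 / real (Suc m)"
proof -
  have "harm (Suc m) \<noteq> (0::real)" using harm_pos[of "Suc m", where 'a = real] by linarith
  then show ?thesis by (simp add: zipf_h_def)
qed

lemma harm_times_one_minus_zipf_h: "harm (Suc m) * (1 - zipf_h (Suc m)) = harm m"
proof -
  have "harm (Suc m) * (1 - zipf_h (Suc m)) = harm (Suc m) - harm (Suc m) * zipf_h (Suc m)"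
    by (simp add: algebra_simps)
  also have "\<dots> = harm m"
    by (simp add: harm_times_zipf_h) (simp add: harm_Suc divide_inverse)
  finally show ?thesis .
qed

text \<open>With the weight \<open>harm m\<close> on the increments, the factor
  \<open>1 - zipf_h (Suc m)\<close> disappears from their recurrence.\<close>

lemma harm_times_occ_incr:
  "harm (Suc m) * occ_incr p (Suc m) = 1 / real (Suc m) + p * (harm m * occ_incr p m)"
proof -
  have "harm (Suc m) * occ_incr p (Suc m)
      = harm (Suc m) * zipf_h (Suc m) + p * ((harm (Suc m) * (1 - zipf_h (Suc m))) * occ_incr p m)"
    by (simp add: algebra_simps)
  then show ?thesis by (simp only: harm_times_zipf_h harm_times_one_minus_zipf_h)
qed

text \<open>Induction reverses the subtraction of consecutive instances: the recurrence of the
  increments is exactly what separates one instance from the next.\<close>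

lemma harm_times_occ_mean:
  "harm m * occ_mean p m
     = harm m + p * harm m * occ_mean p (m - 1) + (1 - p) * (\<Sum>k<m. occ_mean p k / real (Suc k))"
proof (induction m)
  case 0
  show ?case by (simp add: harm_def)
next
  case (Suc m)
  define H L S i d d' where "H = (harm m :: real)" and "L = occ_mean p m"
    and "S = (\<Sum>k<m. occ_mean p k / real (Suc k))" and "i = 1 / real (Suc m)"
    and "d = occ_incr p m" and "d' = occ_incr p (Suc m)"
  have H': "harm (Suc m) = H + i" by (simp add: harm_Suc H_def i_def inverse_eq_divide)
  have pred: "occ_mean p (m - 1) = L - d" using occ_mean_eq_pred[of p m] by (simp add: L_def d_def)
  have IH: "H * L = H + p * H * (L - d) + (1 - p) * S"
    using Suc.IH unfolding pred by (simp add: H_def L_def S_def)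
  have rec: "(H + i) * d' = i + p * (H * d)"
    using harm_times_occ_incr[of m p] unfolding H' by (simp add: H_def i_def d_def d'_def)
  \<comment> \<open>Add \<open>IH\<close> and \<open>rec\<close>, where the terms
    \<open>p * H * d\<close> cancel, and then
    \<open>L * i = p * L * i + (1 - p) * (L * i)\<close>.\<close>
  have "(H + i) * (L + d') = (H + i) + p * (H + i) * L + (1 - p) * (S + L * i)"
    using IH rec by (simp add: algebra_simps)
  moreover have "occ_mean p (Suc m) = L + d'" by (simp add: occ_mean_Suc L_def d'_def)
  moreover have "(\<Sum>k<Suc m. occ_mean p k / real (Suc k)) = S + L * i"
    by (simp add: S_def L_def i_def)
  ultimately show ?case by (simp only: H' diff_Suc_1 L_def)
qed

text \<open>First-step equation of the process: dividing by \<open>harm m\<close> turns the weights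
  into the Zipf probabilities of the seat chosen.\<close>

lemma occ_mean_rec:
  assumes "m \<ge> 1"
  shows "occ_mean p m
     = 1 + p * occ_mean p (m - 1) + (1 - p) * (\<Sum>k=1..m. occ_mean p (k - 1) / (real k * harm m))"
proof -
  define H where "H = (harm m :: real)"
  have pos: "H > 0" unfolding H_def using assms by (intro harm_pos) simp
  have "(\<Sum>k=1..m. occ_mean p (k - 1) / (real k * H)) = (\<Sum>k=1..m. occ_mean p (k - 1) / real k) / H"
    by (simp add: sum_divide_distrib)
  also have "(\<Sum>k=1..m. occ_mean p (k - 1) / real k) = (\<Sum>k<m. occ_mean p k / real (Suc k))"
    by (rule sum.reindex_bij_witness[of _ Suc "\<lambda>k. k - 1"]) auto
  finally have S: "(\<Sum>k=1..m. occ_mean p (k - 1) / (real k * H))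
      = (\<Sum>k<m. occ_mean p k / real (Suc k)) / H" .
  have "H * occ_mean p m = H * (1 + p * occ_mean p (m - 1)
      + (1 - p) * ((\<Sum>k<m. occ_mean p k / real (Suc k)) / H))"
    using harm_times_occ_mean[of m p] pos unfolding H_def[symmetric] by (simp add: distrib_left mult_ac)
  then show ?thesis using pos S unfolding H_def[symmetric] by simp
qed

subsection \<open>A martingale for the seating process\<close>

text \<open>Together with \<open>accessible_upd_Selfish\<close> this shows that a selfish arrival in
  the k-th accessible seat leaves \<open>k - 1\<close> of them, since list indices start at
  0.\<close>

lemma card_less_nth_sorted_list_of_set:
  fixes A :: "'a :: linorder set"
  assumes "finite A" and "i < card A"
  shows "card {u \<in> A. u < sorted_list_of_set A ! i} = i"
proof -
  let ?xs = "sorted_list_of_set A"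
  have len: "length ?xs = card A" using assms by simp
  have strict: "?xs ! a < ?xs ! b" if "a < b" "b < card A" for a b
    using sorted_wrt_nth_less[of "(<)" ?xs a b] that len by simp
  have less_iff: "?xs ! a < ?xs ! i \<longleftrightarrow> a < i" if "a < card A" for a
    using strict[of a i] strict[of i a] that assms(2) by (metis less_asym linorder_less_linear)
  have "{u \<in> A. u < ?xs ! i} = set (take i ?xs)"
  proof -
    have "A = set ?xs" using assms by simp
    then have "{u \<in> A. u < ?xs ! i} = {u \<in> set ?xs. u < ?xs ! i}" by simp
    also have "\<dots> = (\<lambda>a. ?xs ! a) ` {a. a < i}"
      using less_iff assms(2) by (force simp: set_conv_nth[of ?xs] len)
    also have "\<dots> = set (take i ?xs)"
      using nth_image[of i ?xs] assms(2) len by (simp add: lessThan_def atLeast0LessThan)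
    finally show ?thesis .
  qed
  moreover have "distinct (take i ?xs)" by simp
  ultimately show ?thesis using distinct_card[of "take i ?xs"] len assms(2) by simp
qed

lemma card_occupied_upd:
  assumes "s \<in> accessible n \<sigma>"
  shows "card (occupied n (\<sigma>(s \<mapsto> x))) = Suc (card (occupied n \<sigma>))"
proof -
  have "occupied n (\<sigma>(s \<mapsto> x)) = insert s (occupied n \<sigma>)" "s \<notin> occupied n \<sigma>"
    using assms by (auto simp: occupied_def accessible_def)
  moreover have "finite (occupied n \<sigma>)" by (simp add: occupied_def)
  ultimately show ?thesis by simp
qed

lemma accessible_upd_Courteous:
  assumes "s \<in> accessible n \<sigma>"
  shows "accessible n (\<sigma>(s \<mapsto> Courteous)) = accessible n \<sigma> - {s}"
  using assms by (auto simp: accessible_def)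

lemma accessible_upd_Selfish:
  assumes "s \<in> accessible n \<sigma>"
  shows "accessible n (\<sigma>(s \<mapsto> Selfish)) = {u \<in> accessible n \<sigma>. u < s}"
  using assms by (auto simp: accessible_def not_less)

text \<open>Seats already filled plus the expected number still to be filled: the conditional
  expectation of the final count given the current configuration.\<close>

definition row_potential :: "nat \<Rightarrow> real \<Rightarrow> config \<Rightarrow> real" where
  "row_potential n p \<sigma> = real (card (occupied n \<sigma>)) + occ_mean p (card (accessible n \<sigma>))"

text \<open>Finite supports reduce the expectation of a bind to a finite sum.\<close>

lemma finite_set_pmf_arrival: "finite (set_pmf (arrival n p \<sigma>))"
proof (cases "accessible n \<sigma> = {}")
  case False
  then have "card (accessible n \<sigma>) \<ge> 1" by (simp add: Suc_le_eq card_gt_0_iff)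
  then show ?thesis using False by (simp add: arrival_def Let_def set_zipf_pmf)
qed (simp add: arrival_def)

lemma finite_set_pmf_row_process: "finite (set_pmf (row_process n p t))"
  by (induction t) (simp_all add: finite_set_pmf_arrival)

lemma expectation_zipf_pmf:
  fixes f :: "nat \<Rightarrow> real"
  assumes "m \<ge> 1"
  shows "measure_pmf.expectation (zipf_pmf m) f = (\<Sum>k=1..m. f k / (real k * harm m))"
proof -
  have "measure_pmf.expectation (zipf_pmf m) f = (\<Sum>k\<in>{1..m}. f k * pmf (zipf_pmf m) k)"
    by (rule integral_measure_pmf_real) (use set_zipf_pmf[OF assms] in auto)
  also have "\<dots> = (\<Sum>k=1..m. f k / (real k * harm m))"
    by (rule sum.cong) (simp_all add: pmf_zipf_pmf[OF assms])
  finally show ?thesis .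
qed

text \<open>The Zipf distribution has total mass 1, so a constant is its own expectation.\<close>

lemma sum_inverse_times_harm:
  assumes "m \<ge> 1"
  shows "(\<Sum>k=1..m. c / (real k * harm m)) = c"
  using expectation_zipf_pmf[OF assms, of "\<lambda>_. c"] by simp

text \<open>Every arrival fills one seat. A courteous one leaves \<open>m - 1\<close> accessible
  seats wherever she sits, a selfish one in the k-th seat leaves \<open>k - 1\<close>; averaging the
  potential over both cases gives the right side of \<open>occ_mean_rec\<close>.\<close>

lemma expectation_row_potential_arrival:
  assumes "0 \<le> p" and "p \<le> 1"
  shows "measure_pmf.expectation (arrival n p \<sigma>) (row_potential n p) = row_potential n p \<sigma>"
proof (cases "accessible n \<sigma> = {}")
  case True
  then show ?thesis by (simp add: arrival_def)
next
  case False
  define A m where "A = accessible n \<sigma>" and "m = card A"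
  define seat where "seat k = sorted_list_of_set A ! (k - 1)" for k
  define c where "c = real (card (occupied n \<sigma>))"
  have m: "m \<ge> 1" using False by (simp add: m_def A_def Suc_le_eq card_gt_0_iff)
  have finA: "finite A" by (simp add: A_def)
  have seat: "seat k \<in> A" if "k \<in> {1..m}" for k
  proof -
    have "k - 1 < length (sorted_list_of_set A)" using that by (auto simp: m_def)
    then show ?thesis unfolding seat_def using finA by (metis nth_mem set_sorted_list_of_set)
  qed
  define step where "step b = map_pmf (\<lambda>k. \<sigma>(seat k \<mapsto> (if b then Courteous else Selfish))) (zipf_pmf m)"
    for b
  have arr: "arrival n p \<sigma> = bind_pmf (bernoulli_pmf p) step"
    using False by (simp add: arrival_def Let_def step_def[abs_def] map_pmf_def seat_def A_def m_def)
  have fin: "finite (set_pmf (step b))" for b by (simp add: step_def set_zipf_pmf[OF m])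
  have courteous: "measure_pmf.expectation (step True) (row_potential n p) = c + 1 + occ_mean p (m - 1)"
  proof -
    have "measure_pmf.expectation (step True) (row_potential n p)
        = (\<Sum>k=1..m. row_potential n p (\<sigma>(seat k \<mapsto> Courteous)) / (real k * harm m))"
      by (simp add: step_def expectation_zipf_pmf[OF m])
    also have "\<dots> = (\<Sum>k=1..m. (c + 1 + occ_mean p (m - 1)) / (real k * harm m))"
    proof (rule sum.cong[OF refl])
      fix k assume "k \<in> {1..m}"
      then have s: "seat k \<in> accessible n \<sigma>" using seat by (simp add: A_def)
      have "card (accessible n \<sigma> - {seat k}) = m - 1" using s by (simp add: m_def A_def)
      then show "row_potential n p (\<sigma>(seat k \<mapsto> Courteous)) / (real k * harm m)
          = (c + 1 + occ_mean p (m - 1)) / (real k * harm m)"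
        by (simp add: row_potential_def card_occupied_upd[OF s] accessible_upd_Courteous[OF s] c_def)
    qed
    finally show ?thesis by (simp only: sum_inverse_times_harm[OF m])
  qed
  have selfish: "measure_pmf.expectation (step False) (row_potential n p)
      = c + 1 + (\<Sum>k=1..m. occ_mean p (k - 1) / (real k * harm m))"
  proof -
    have "measure_pmf.expectation (step False) (row_potential n p)
        = (\<Sum>k=1..m. row_potential n p (\<sigma>(seat k \<mapsto> Selfish)) / (real k * harm m))"
      by (simp add: step_def expectation_zipf_pmf[OF m])
    also have "\<dots> = (\<Sum>k=1..m. (c + 1) / (real k * harm m) + occ_mean p (k - 1) / (real k * harm m))"
    proof (rule sum.cong[OF refl])
      fix k assume k: "k \<in> {1..m}"
      then have s: "seat k \<in> accessible n \<sigma>" using seat by (simp add: A_def)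
      have "k - 1 < card A" using k by (auto simp: m_def)
      then have "card {u \<in> accessible n \<sigma>. u < seat k} = k - 1"
        using card_less_nth_sorted_list_of_set[OF finA] by (simp add: A_def seat_def)
      then show "row_potential n p (\<sigma>(seat k \<mapsto> Selfish)) / (real k * harm m)
          = (c + 1) / (real k * harm m) + occ_mean p (k - 1) / (real k * harm m)"
        by (simp add: row_potential_def card_occupied_upd[OF s] accessible_upd_Selfish[OF s] c_def
            add_divide_distrib)
    qed
    finally show ?thesis by (simp only: sum.distrib sum_inverse_times_harm[OF m])
  qed
  have "measure_pmf.expectation (arrival n p \<sigma>) (row_potential n p)
      = (\<Sum>b\<in>UNIV. pmf (bernoulli_pmf p) b *\<^sub>R measure_pmf.expectation (step b) (row_potential n p))"
    unfolding arr by (rule pmf_expectation_bind) (simp_all add: fin)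
  also have "\<dots> = p * (c + 1 + occ_mean p (m - 1))
      + (1 - p) * (c + 1 + (\<Sum>k=1..m. occ_mean p (k - 1) / (real k * harm m)))"
    using assms by (simp only: UNIV_bool) (simp add: courteous selfish)
  also have "\<dots> = c + occ_mean p m"
    unfolding occ_mean_rec[OF m, of p] by (simp add: algebra_simps)
  finally show ?thesis by (simp add: row_potential_def c_def m_def A_def)
qed

text \<open>The expectation keeps its initial value, and the empty row has \<open>n\<close>
  accessible seats and none occupied.\<close>

lemma expectation_row_potential_row_process:
  assumes "0 \<le> p" and "p \<le> 1"
  shows "measure_pmf.expectation (row_process n p t) (row_potential n p) = occ_mean p n"
proof (induction t)
  case 0
  have "accessible n Map.empty = {1..n}" "occupied n Map.empty = {}"
    by (auto simp: accessible_def occupied_def)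
  then show ?case by (simp add: row_potential_def)
next
  case (Suc t)
  let ?R = "row_process n p t"
  have "measure_pmf.expectation (row_process n p (Suc t)) (row_potential n p)
      = (\<Sum>\<sigma>\<in>set_pmf ?R. pmf ?R \<sigma> *\<^sub>R measure_pmf.expectation (arrival n p \<sigma>) (row_potential n p))"
    unfolding row_process.simps
    by (rule pmf_expectation_bind) (simp_all add: finite_set_pmf_row_process finite_set_pmf_arrival)
  also have "\<dots> = (\<Sum>\<sigma>\<in>set_pmf ?R. pmf ?R \<sigma> *\<^sub>R row_potential n p \<sigma>)"
    by (simp only: expectation_row_potential_arrival[OF assms])
  also have "\<dots> = measure_pmf.expectation ?R (row_potential n p)"
    by (rule integral_measure_pmf[symmetric]) (simp_all add: finite_set_pmf_row_process)
  finally show ?case using Suc.IH by simp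
qed

text \<open>After \<open>n\<close> arrivals no seat is accessible, and
  \<open>occ_mean p 0 = 0\<close>, so the potential has become the number of occupied seats.\<close>

lemma expected_occupied_eq_occ_mean:
  assumes "0 \<le> p" and "p \<le> 1"
  shows "expected_occupied p n = occ_mean p n"
proof -
  have "expected_occupied p n = measure_pmf.expectation (final_config n p) (row_potential n p)"
    unfolding expected_occupied_def
    by (rule integral_cong_AE)
       (auto simp: AE_measure_pmf_iff row_potential_def row_process_ended)
  then show ?thesis
    using expectation_row_potential_row_process[OF assms] by (simp add: final_config_def)
qed

subsection \<open>Asymptotics\<close>

text \<open>Here k counts how often the recurrence is unfolded before the inhomogeneous term is
  taken; unfolding stops at \<open>zipf_h 0 = 0\<close>.\<close>

lemma occ_incr_eq_sum:
  "occ_incr p l = (\<Sum>k=0..l. p ^ k * (\<Prod>j=l-k+1..l. 1 - zipf_h j) * zipf_h (l - k))"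
proof (induction l)
  case 0
  show ?case by (simp add: zipf_h_def)
next
  case (Suc l)
  \<comment> \<open>Raising \<open>l\<close> and \<open>k\<close> together keeps the lower end of
    the product, so only the factor at \<open>Suc l\<close> is new.\<close>
  have prod: "(\<Prod>j=Suc l - Suc k + 1..Suc l. 1 - zipf_h j)
      = (1 - zipf_h (Suc l)) * (\<Prod>j=l-k+1..l. 1 - zipf_h j)" for k
    by (simp add: prod.nat_ivl_Suc' Suc_diff_le del: One_nat_def)
  have "(\<Sum>k=0..Suc l. p ^ k * (\<Prod>j=Suc l-k+1..Suc l. 1 - zipf_h j) * zipf_h (Suc l - k))
      = zipf_h (Suc l)
        + (\<Sum>k=0..l. p ^ Suc k * (\<Prod>j=Suc l-Suc k+1..Suc l. 1 - zipf_h j) * zipf_h (Suc l - Suc k))"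
    by (subst sum.atLeast0_atMost_Suc_shift) (simp del: prod.cl_ivl_Suc)
  also have "\<dots> = zipf_h (Suc l) + p * (1 - zipf_h (Suc l)) *
      (\<Sum>k=0..l. p ^ k * (\<Prod>j=l-k+1..l. 1 - zipf_h j) * zipf_h (l - k))"
    by (simp only: prod) (simp add: sum_distrib_left mult_ac del: prod.cl_ivl_Suc)
  finally show ?case using Suc.IH by simp
qed

text \<open>The terms with \<open>k = 0\<close> have an empty product and form the first
  sum.\<close>

lemma occ_mean_eq_sum:
  "occ_mean p n = (\<Sum>l=1..n. zipf_h l)
     + (\<Sum>l=1..n. \<Sum>k=1..l. p ^ k * (\<Prod>j=l-k+1..l. 1 - zipf_h j) * zipf_h (l - k))"
  unfolding occ_mean_def sum.distrib[symmetric]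
  by (intro sum.cong refl) (simp add: occ_incr_eq_sum sum.atLeast_Suc_atMost)

section \<open>Bounds for the increments and growth of the sum of \<open>zipf_h\<close>\<close>

lemma zipf_h_nonneg: "0 \<le> zipf_h k"
  by (simp add: zipf_h_def harm_nonneg)

lemma harm_ge_1: "n \<ge> 1 \<Longrightarrow> harm n \<ge> (1::real)"
  using harm_mono[of 1 n, where 'a = real] by (simp add: harm_def)

lemma zipf_h_le_inverse: "zipf_h k \<le> 1 / real k"
proof (cases "k = 0")
  case False
  then have "real k * 1 \<le> real k * harm k" by (intro mult_left_mono harm_ge_1) auto
  with False show ?thesis by (auto simp: zipf_h_def intro!: divide_left_mono)
qed (simp add: zipf_h_def)

lemma zipf_h_le_1: "zipf_h k \<le> 1"
proof (cases "k = 0")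
  case False
  then have "1 / real k \<le> 1" by simp
  then show ?thesis using zipf_h_le_inverse[of k] by linarith
qed (simp add: zipf_h_def)

lemma occ_incr_nonneg: "0 \<le> p \<Longrightarrow> 0 \<le> occ_incr p l"
  by (induction l) (simp_all add: zipf_h_nonneg zipf_h_le_1)

lemma occ_mean_le:
  assumes "0 \<le> p"
  shows "(1 - p) * occ_mean p n \<le> (\<Sum>l=1..n. zipf_h l)"
proof -
  \<comment> \<open>Summing \<open>d l \<le> zipf_h l + p * d (l - 1)\<close> puts only
    \<open>p * occ_mean p (n - 1)\<close> on the right; the extra \<open>p * occ_incr p n\<close> on
    the left compensates for the missing last term.\<close>
  have "occ_mean p n + p * occ_incr p n \<le> (\<Sum>l=1..n. zipf_h l) + p * occ_mean p n"
  proof (induction n)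
    case (Suc n)
    have "occ_incr p (Suc n) \<le> zipf_h (Suc n) + p * occ_incr p n"
      using assms zipf_h_nonneg[of "Suc n"] occ_incr_nonneg[OF assms, of n]
      by (simp add: mult_left_le_one_le mult_right_mono mult_le_cancel_right1 algebra_simps)
    then show ?case using Suc.IH by (simp add: occ_mean_Suc algebra_simps del: occ_incr.simps)
  qed simp
  moreover have "0 \<le> p * occ_incr p n" using assms occ_incr_nonneg by simp
  ultimately show ?thesis by (simp add: algebra_simps)
qed

text \<open>The difference of logarithms is \<open>- ln (1 - h)\<close> with
  \<open>h = zipf_h (Suc m)\<close>, which is estimated to second order in \<open>h\<close>.\<close>

lemma ln_harm_diff_bounds:
  assumes "m \<ge> 1"
  shows "zipf_h (Suc m) \<le> ln (harm (Suc m)) - ln (harm m)"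
    and "ln (harm (Suc m)) - ln (harm m) \<le> zipf_h (Suc m) + 2 * (zipf_h (Suc m))\<^sup>2"
proof -
  let ?h = "zipf_h (Suc m)"
  have pos: "harm m > (0::real)" "harm (Suc m) > (0::real)" using assms by (auto intro: harm_pos)
  \<comment> \<open>The quadratic bound for \<open>ln (1 - h)\<close> requires
    \<open>h \<le> 1 / 2\<close>, which holds from the second seat on.\<close>
  have "1 / real (Suc m) \<le> 1 / 2" using assms by (intro divide_left_mono) auto
  then have h: "0 \<le> ?h" "?h \<le> 1 / 2"
    using zipf_h_nonneg[of "Suc m"] zipf_h_le_inverse[of "Suc m"] by linarith+
  have "1 - ?h = harm m / harm (Suc m)"
    using harm_times_one_minus_zipf_h[of m] pos(2) by (metis nonzero_mult_div_cancel_left less_irrefl)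
  then have ln: "ln (1 - ?h) = ln (harm m) - ln (harm (Suc m))"
    using ln_divide_pos[OF pos] by simp
  show "?h \<le> ln (harm (Suc m)) - ln (harm m)"
    using ln_one_minus_pos_upper_bound[of ?h] h ln by simp
  show "ln (harm (Suc m)) - ln (harm m) \<le> ?h + 2 * ?h\<^sup>2"
    using ln_one_minus_pos_lower_bound[of ?h] h ln by simp
qed

text \<open>The differences of \<open>ln (harm l)\<close> telescope from \<open>l = 1\<close>, where
  \<open>zipf_h 1 = 1\<close> and \<open>ln (harm 1) = 0\<close>; the quadratic errors have a
  bounded sum.\<close>

lemma sum_zipf_h_bounds:
  assumes "n \<ge> 1"
  shows "(\<Sum>l=1..n. zipf_h l) \<le> ln (harm n) + 1"
    and "ln (harm n) \<le> (\<Sum>l=1..n. zipf_h l) + 2"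
proof -
  have h1: "zipf_h 1 = 1" by (simp add: zipf_h_def harm_def)
  show "(\<Sum>l=1..n. zipf_h l) \<le> ln (harm n) + 1"
    using assms
  proof (induction n rule: nat_induct_at_least)
    case base
    show ?case using h1 by (simp add: harm_def)
  next
    case (Suc n)
    then show ?case using ln_harm_diff_bounds(1)[of n] by simp
  qed
  \<comment> \<open>The slack \<open>2 / real n\<close> absorbs the errors in the induction, as
    \<open>1 / (n + 1)^2 \<le> 1 / n - 1 / (n + 1)\<close>.\<close>
  have "ln (harm n) \<le> (\<Sum>l=1..n. zipf_h l) + 2 - 2 / real n"
    using assms
  proof (induction n rule: nat_induct_at_least)
    case base
    show ?case using h1 by (simp add: harm_def)
  next
    case (Suc n)
    have "(zipf_h (Suc n))\<^sup>2 \<le> (1 / real (Suc n))\<^sup>2"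
      by (intro power_mono zipf_h_le_inverse zipf_h_nonneg)
    also have "\<dots> \<le> 1 / real n - 1 / real (Suc n)"
    proof -
      have "1 / real n - 1 / real (Suc n) = 1 / (real n * real (Suc n))"
        using Suc.hyps by (simp add: field_simps)
      moreover have "(1 / real (Suc n))\<^sup>2 \<le> 1 / (real n * real (Suc n))"
        unfolding power_divide power_one power2_eq_square[of "real (Suc n)"] using Suc.hyps
        by (intro divide_left_mono mult_right_mono) auto
      ultimately show ?thesis by simp
    qed
    finally show ?case using Suc ln_harm_diff_bounds(2)[of n] by simp
  qed
  then show "ln (harm n) \<le> (\<Sum>l=1..n. zipf_h l) + 2"
    using divide_nonneg_nonneg[of 2 "real n"] by linarith
qed

text \<open>The difference of \<open>harm n\<close> and \<open>ln n\<close> decreases and equals 1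
  at \<open>n = 1\<close>.\<close>

lemma harm_le_ln_plus_1:
  assumes "n \<ge> 1"
  shows "harm n \<le> ln (real n) + 1"
proof -
  obtain m where m: "n = Suc m" using assms by (cases n) auto
  have "harm (Suc m) - ln (real (Suc m)) \<le> harm (Suc 0) - ln (real (Suc 0))"
    using decseq_harm_diff_ln unfolding decseq_def by blast
  then show ?thesis by (simp add: m harm_def)
qed

text \<open>For \<open>n \<ge> 3 \<ge> exp 1\<close>, \<open>harm n\<close> lies between
  \<open>ln n\<close> and \<open>2 * ln n\<close>. Taking logarithms costs at most
  \<open>ln 2 \<le> 1\<close>, on top of the constants in \<open>sum_zipf_h_bounds\<close>.\<close>

lemma abs_sum_zipf_h_minus_ln_ln_le:
  assumes "n \<ge> 3"
  shows "\<bar>(\<Sum>l=1..n. zipf_h l) - ln (ln (real n))\<bar> \<le> 2"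
proof -
  have "exp 1 \<le> (3::real)" using exp_le by simp
  then have "ln (exp 1) \<le> ln (real n)" using assms by (subst ln_le_cancel_iff) auto
  then have ln1: "1 \<le> ln (real n)" by simp
  have "ln (real n) \<le> ln (real n + 1)" using assms by simp
  then have lo: "ln (real n) \<le> harm n" using ln_le_harm[of n] by linarith
  have hi: "harm n \<le> 2 * ln (real n)" using harm_le_ln_plus_1[of n] assms ln1 by simp
  have "ln (ln (real n)) \<le> ln (harm n)" using lo ln1 assms by (subst ln_le_cancel_iff) auto
  moreover have "ln (harm n) \<le> ln (2 * ln (real n))" using lo hi ln1 assms by (subst ln_le_cancel_iff) auto
  then have "ln (harm n) \<le> ln 2 + ln (ln (real n))" using ln1 by (simp add: ln_mult)
  moreover have "ln 2 \<le> (1::real)" using ln_le_minus_one[of 2] by simp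
  ultimately show ?thesis using sum_zipf_h_bounds[of n] assms by linarith
qed

lemma ln_ln_at_top: "filterlim (\<lambda>n. ln (ln (real n))) at_top at_top"
  by (intro filterlim_compose[OF ln_at_top] filterlim_real_sequentially)

theorem theorem9:
  fixes p :: real
  assumes "0 < p" and "p < 1"
  shows "expected_occupied p \<sim>[at_top]
           (\<lambda>n. ln (ln (real n)) +
              (\<Sum>l=1..n. \<Sum>k=1..l.
                 p ^ k * (\<Prod>j=l-k+1..l. 1 - zipf_h j) * zipf_h (l - k)))
       \<and> expected_occupied p \<in> \<Theta>[at_top](\<lambda>n. ln (ln (real n)) / (1 - p))"
proof
  define A where "A n = (\<Sum>l=1..n. zipf_h l)" for n
  define S where "S n = (\<Sum>l=1..n. \<Sum>k=1..l.
      p ^ k * (\<Prod>j=l-k+1..l. 1 - zipf_h j) * zipf_h (l - k))" for n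
  have L: "expected_occupied p n = A n + S n" for n
    using expected_occupied_eq_occ_mean[of p n] occ_mean_eq_sum[of p n] assms
    by (simp add: A_def S_def)
  have S: "0 \<le> S n" for n
    unfolding S_def using assms
    by (intro sum_nonneg mult_nonneg_nonneg prod_nonneg) (auto simp: zipf_h_nonneg zipf_h_le_1)
  have A: "\<bar>A n - ln (ln (real n))\<bar> \<le> 2" if "n \<ge> 3" for n
    using abs_sum_zipf_h_minus_ln_ln_le[OF that] by (simp add: A_def)
  have large: "\<forall>\<^sub>F n in at_top. n \<ge> 3 \<and> ln (ln (real n)) \<ge> c" for c
    using ln_ln_at_top by (intro eventually_conj eventually_ge_at_top) (auto simp: filterlim_at_top)

  show "expected_occupied p \<sim>[at_top] (\<lambda>n. ln (ln (real n)) +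
              (\<Sum>l=1..n. \<Sum>k=1..l.
                 p ^ k * (\<Prod>j=l-k+1..l. 1 - zipf_h j) * zipf_h (l - k)))"
    unfolding S_def[symmetric]
  proof (rule smallo_imp_asymp_equiv, rule landau_o.smallI)
    fix c :: real assume c: "c > 0"
    \<comment> \<open>The difference is \<open>A n - ln (ln n)\<close>, bounded by 2, while the
      right side is at least \<open>c * ln (ln n)\<close> because \<open>S n\<close> is nonnegative.
      The threshold \<open>2 / c\<close> makes the latter at least 2.\<close>
    show "\<forall>\<^sub>F n in at_top. norm (expected_occupied p n - (ln (ln (real n)) + S n))
        \<le> c * norm (ln (ln (real n)) + S n)"
      using large[of "2 / c"]
    proof eventually_elim
      case (elim n)
      have "\<bar>expected_occupied p n - (ln (ln (real n)) + S n)\<bar> \<le> 2" using A elim by (simp add: L)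
      also have "2 \<le> c * ln (ln (real n))" using elim c by (simp add: field_simps)
      also have "\<dots> \<le> c * \<bar>ln (ln (real n)) + S n\<bar>" using S[of n] c by (intro mult_left_mono) auto
      finally show ?case by simp
    qed
  qed

  have upper: "(1 - p) * expected_occupied p n \<le> A n" for n
    using occ_mean_le[of p n] expected_occupied_eq_occ_mean[of p n] assms by (simp add: A_def)
  show "expected_occupied p \<in> \<Theta>[at_top](\<lambda>n. ln (ln (real n)) / (1 - p))"
  proof (rule bigthetaI)
    show "expected_occupied p \<in> O[at_top](\<lambda>n. ln (ln (real n)) / (1 - p))"
    proof (rule bigoI[of _ 2])
      \<comment> \<open>Once \<open>ln (ln n) \<ge> 2\<close>, the additive error 2 is absorbed by
        doubling, and \<open>upper\<close> supplies the factor \<open>1 / (1 - p)\<close>.\<close>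
      show "\<forall>\<^sub>F n in at_top. norm (expected_occupied p n) \<le> 2 * norm (ln (ln (real n)) / (1 - p))"
        using large[of 2]
      proof eventually_elim
        case (elim n)
        then have "0 \<le> A n" "A n \<le> 2 * ln (ln (real n))" using A[of n] by linarith+
        then have "0 \<le> expected_occupied p n" "(1 - p) * expected_occupied p n \<le> 2 * ln (ln (real n))"
          using L[of n] S[of n] upper[of n] by linarith+
        then show ?case using assms elim by (simp add: field_simps)
      qed
    qed
    show "expected_occupied p \<in> \<Omega>[at_top](\<lambda>n. ln (ln (real n)) / (1 - p))"
    proof (rule landau_omega.bigI[of "(1 - p) / 2"])
      \<comment> \<open>Already \<open>A n\<close> suffices: once \<open>ln (ln n) \<ge> 4\<close>,
        subtracting 2 leaves at least half. The factor \<open>1 - p\<close> in the constant cancels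
        the denominator.\<close>
      show "\<forall>\<^sub>F n in at_top. norm (expected_occupied p n)
          \<ge> (1 - p) / 2 * norm (ln (ln (real n)) / (1 - p))"
        using large[of 4]
      proof eventually_elim
        case (elim n)
        then have "ln (ln (real n)) / 2 \<le> expected_occupied p n"
          using A[of n] L[of n] S[of n] by linarith
        moreover have "(1 - p) / 2 * norm (ln (ln (real n)) / (1 - p)) = ln (ln (real n)) / 2"
          using assms conjunct2[OF elim] by (simp add: field_simps)
        ultimately show ?case by (simp only: real_norm_def abs_ge_self order_trans[OF _ abs_ge_self])
      qed
    qed (use assms in simp)
  qed
qed

end
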